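(* Let $u\in C^2(\overline\Omega)$ be such that $|\nabla u|\ge c$ in $\overline\Omega$ for a constant $c>0$, let $\Lambda_{\max}$ denote the largest eigenvalue of the Hessian of $u$ over $\Omega$, and let $0<\varepsilon<c/\Lambda_{\max}$ be small enough. For $x\in\Omega_\varepsilon$ let $\Gamma_\varepsilon(x)$ and $\gamma_\varepsilon(x)$ be the (for such $\varepsilon$ unique) maximizer and minimizer, respectively, of $u$ over $\overline{B(x,\varepsilon)\cap\Omega}$. Then $$\frac{\mathrm{d}}{\mathrm{d}\mathcal{L}^N}\Big[\frac{(\Gamma_\varepsilon)_\sharp\varrho_0-\varrho_0}{\varepsilon}+\frac{\varrho_1-(\gamma_\varepsilon)_\sharp\varrho_1}{\varepsilon}\Big]=-\operatorname{div}\Big(\varrho\,\frac{\nabla u}{|\nabla u|}\Big)+o_{\varepsilon\to0}(1)\quad\text{uniformly in }\Omega_{2\varepsilon}.$$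
   Context: Setting. $\Omega\subset\mathbb{R}^N$ is a bounded domain (non-empty, open, connected). $\mu$ is a probability measure on $\Omega\times\{0,1\}$; $\varrho_i:=\mu(\cdot\times\{i\})$ for $i=0,1$, and $\varrho:=\varrho_0+\varrho_1$. The measures $\varrho_0,\varrho_1$ have densities with respect to the Lebesgue measure $\mathcal{L}^N$ on $\Omega$, denoted by the same symbols, which are continuously differentiable, $\varrho_i\in C^1(\Omega)$, and there is a constant $c_\varrho>0$ with $c_\varrho<\varrho<c_\varrho^{-1}$ in $\Omega$. $B(x,\varepsilon)$ is the open Euclidean ball. For $a>0$, $\Omega_a:=\{x\in\Omega:\operatorname{dist}(x,\mathbb{R}^N\setminus\Omega)>a\}$. The maps $\Gamma_\varepsilon,\gamma_\varepsilon$ are defined on $\Omega_\varepsilon$, the pushforwards are those of $\varrho_0,\varrho_1$ restricted to $\Omega_\varepsilon$, and $\frac{\mathrm d}{\mathrm d\mathcal L^N}$ denotes the density with respect to $\mathcal{L}^N$, which for the pushforwards exists on $\Omega_{2\varepsilon}$.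
   Formalization: With ϱ_i only in C¹(Ω) the error need not be uniform in Ω_{2ε} (e.g. sin(1/x) oscillation in ϱ_0 near the boundary); uniformity in Ω_{2ε} is stated when ∇ϱ_0, ∇ϱ_1 are uniformly continuous on Ω, and for general C¹(Ω) uniformly on each fixed Ω_δ. *)

theory Defs
  imports "HOL-Probability.Probability"
begin

definition inner_region :: "(real^'n) set \<Rightarrow> real \<Rightarrow> (real^'n) set" where
  "inner_region \<Omega> a = {x \<in> \<Omega>. infdist x (- \<Omega>) > a}"

definition C1_on :: "(real^'n) set \<Rightarrow> (real^'n \<Rightarrow> real) \<Rightarrow> (real^'n \<Rightarrow> real^'n) \<Rightarrow> bool" where
  "C1_on \<Omega> f Df \<longleftrightarrow> (\<forall>x\<in>\<Omega>. GDERIV f x :> Df x) \<and> continuous_on \<Omega> Df"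

text \<open>The function, its gradient and its Hessian are differentiated only inside the open set
  \<open>\<Omega>\<close>; on the boundary \<open>u\<close>, \<open>Du\<close> and \<open>D2u\<close> are the continuous extensions.\<close>

definition C2_on_closure ::
    "(real^'n) set \<Rightarrow> (real^'n \<Rightarrow> real) \<Rightarrow> (real^'n \<Rightarrow> real^'n) \<Rightarrow> (real^'n \<Rightarrow> real^'n^'n) \<Rightarrow> bool" where
  "C2_on_closure \<Omega> u Du D2u \<longleftrightarrow>
     (\<forall>x\<in>\<Omega>. GDERIV u x :> Du x) \<and>
     (\<forall>x\<in>\<Omega>. (Du has_derivative (\<lambda>h. D2u x *v h)) (at x)) \<and>
     continuous_on (closure \<Omega>) u \<and>
     continuous_on (closure \<Omega>) Du \<and>
     continuous_on (closure \<Omega>) D2u"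

definition eigenvalue_of :: "real^'n^'n \<Rightarrow> real \<Rightarrow> bool" where
  "eigenvalue_of A l \<longleftrightarrow> (\<exists>v. v \<noteq> 0 \<and> A *v v = l *\<^sub>R v)"

definition max_eigenvalue :: "(real^'n) set \<Rightarrow> (real^'n \<Rightarrow> real^'n^'n) \<Rightarrow> real" where
  "max_eigenvalue \<Omega> H = Sup {l. \<exists>x\<in>\<Omega>. eigenvalue_of (H x) l}"

definition divergence :: "(real^'n \<Rightarrow> real^'n) \<Rightarrow> real^'n \<Rightarrow> real" where
  "divergence F x = trace (jacobian F (at x))"

definition ball_argmax :: "(real^'n) set \<Rightarrow> (real^'n \<Rightarrow> real) \<Rightarrow> real \<Rightarrow> real^'n \<Rightarrow> real^'n" where
  "ball_argmax \<Omega> u \<epsilon> x = arg_max u (\<lambda>y. y \<in> closure (ball x \<epsilon> \<inter> \<Omega>))"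

definition ball_argmin :: "(real^'n) set \<Rightarrow> (real^'n \<Rightarrow> real) \<Rightarrow> real \<Rightarrow> real^'n \<Rightarrow> real^'n" where
  "ball_argmin \<Omega> u \<epsilon> x = arg_min u (\<lambda>y. y \<in> closure (ball x \<epsilon> \<inter> \<Omega>))"

definition class_measure ::
    "(real^'n) set \<Rightarrow> ((real^'n) \<times> nat) measure \<Rightarrow> nat \<Rightarrow> (real^'n) measure" where
  "class_measure \<Omega> \<mu> i =
     measure_of \<Omega> (sets (restrict_space borel \<Omega>)) (\<lambda>A. emeasure \<mu> (A \<times> {i}))"

text \<open>A map defined on \<open>S\<close> pushes forward the restriction of the measure to \<open>S\<close>; the result is
  a measure on the whole space.\<close>

definition push_from ::
    "(real^'n) set \<Rightarrow> (real^'n \<Rightarrow> real^'n) \<Rightarrow> (real^'n) measure \<Rightarrow> (real^'n) measure" where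
  "push_from S T \<nu> = distr (restrict_space \<nu> S) borel T"

text \<open>Differences of measures are signed, so they are represented here by real-valued set
  functions, and the density is taken on a Borel set \<open>S\<close> only.\<close>

definition has_lebesgue_density_on ::
    "((real^'n) set \<Rightarrow> real) \<Rightarrow> (real^'n \<Rightarrow> real) \<Rightarrow> (real^'n) set \<Rightarrow> bool" where
  "has_lebesgue_density_on \<nu> f S \<longleftrightarrow>
     set_integrable lborel S f \<and>
     (\<forall>A\<in>sets borel. A \<subseteq> S \<longrightarrow> \<nu> A = (LINT x:A|lborel. f x))"

end

theory Submission
  imports Defs
begin

text \<open>A maximizer \<open>y\<close> of \<open>u\<close> over the closed ball of radius \<open>\<epsilon>\<close> around \<open>x\<close> satisfies
  \<open>x = y - \<epsilon> n y\<close> with \<open>n = \<nabla>u / |\<nabla>u|\<close>. Since \<open>n\<close> is Lipschitz on convex subsets of \<open>\<Omega>\<close>, this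
  equation has a unique solution for small \<open>\<epsilon>\<close>, so the argmax map inverts the explicit map
  \<open>y \<mapsto> y - \<epsilon> n y\<close>. By change of variables the pushforward has density
  \<open>\<bar>det (1 - \<epsilon> Dn y)\<bar> \<rho> (y - \<epsilon> n y)\<close>, and since the derivative of the determinant at the identity is
  the trace, this is \<open>\<rho> - \<epsilon> div (\<rho> n) + o(\<epsilon>)\<close>. The argmin map is the same with \<open>- u\<close> and
  \<open>- n\<close>. The error is uniform wherever the gradients of the densities are uniformly continuous
  along the segments from \<open>y\<close> to \<open>y \<plusminus> \<epsilon> n y\<close>.\<close>

section \<open>The determinant near the identity\<close>

text \<open>A non-identity permutation moves some \<open>k\<close> and then also \<open>p k\<close>.
  At most one of the two is the removed index \<open>i\<close>, so an off-diagonal zero of the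
  identity matrix remains among the factors.\<close>

lemma prod_identity_minors:
  fixes p :: "'n::finite \<Rightarrow> 'n"
  assumes "p permutes UNIV" "p \<noteq> id"
  shows "(\<Prod>j\<in>UNIV - {i}. (mat 1 :: real^'n^'n) $ j $ p j) = 0"
proof -
  obtain k where k: "p k \<noteq> k"
    using assms(2) by (auto simp: fun_eq_iff)
  have "p (p k) \<noteq> p k"
    using k assms(1) by (metis permutes_inv_eq)
  with k obtain j where "j \<noteq> i" "p j \<noteq> j"
    by metis
  then show ?thesis
    by (intro prod_zero) (auto simp: mat_def intro!: bexI[of _ j])
qed

text \<open>The Leibniz sum is differentiated term by term. The product rule leaves out one factor
  at a time, so by \<open>prod_identity_minors\<close> only the identity permutation survives, and
  it contributes the diagonal entries.\<close>

lemma has_derivative_det_mat_1: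
  "((det :: real^'n^'n \<Rightarrow> real) has_derivative trace) (at (mat 1))"
proof -
  let ?P = "{p. p permutes (UNIV :: 'n set)}"
  let ?D = "\<lambda>H :: real^'n^'n. \<Sum>p\<in>?P. of_int (sign p) *
      (\<Sum>i\<in>UNIV. H $ i $ p i * (\<Prod>j\<in>UNIV - {i}. (mat 1 :: real^'n^'n) $ j $ p j))"
  have comp: "((\<lambda>A :: real^'n^'n. A $ i $ j) has_derivative (\<lambda>H. H $ i $ j)) F" for i j F
    by (intro bounded_linear_imp_has_derivative bounded_linear_compose[OF bounded_linear_vec_nth]
        bounded_linear_vec_nth)
  have "((\<lambda>A :: real^'n^'n. det A) has_derivative ?D) (at (mat 1))"
    unfolding det_def
    by (intro has_derivative_sum has_derivative_mult_right has_derivative_prod comp)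
  moreover have "?D = trace"
  proof
    fix H :: "real^'n^'n"
    have "?D H = (\<Sum>p\<in>?P. if p = id then trace H else 0)"
    proof (intro sum.cong refl)
      fix p assume "p \<in> ?P"
      then show "of_int (sign p) * (\<Sum>i\<in>UNIV. H $ i $ p i *
          (\<Prod>j\<in>UNIV - {i}. (mat 1 :: real^'n^'n) $ j $ p j)) = (if p = id then trace H else 0)"
        by (cases "p = id") (simp_all add: prod_identity_minors, simp add: trace_def mat_def sign_id)
    qed
    also have "\<dots> = trace H"
      by (simp add: permutes_id finite_permutations)
    finally show "?D H = trace H" .
  qed
  ultimately show ?thesis by (simp add: eta_contract_eq)
qed

text \<open>By continuity the determinant is positive near the identity, so the absolute value does
  not change the derivative there.\<close>

lemma has_derivative_abs_det_mat_1:
  "((\<lambda>A :: real^'n^'n. \<bar>det A\<bar>) has_derivative trace) (at (mat 1))"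
proof -
  have "isCont (det :: real^'n^'n \<Rightarrow> real) (mat 1)"
    using has_derivative_det_mat_1 has_derivative_continuous by blast
  then have "\<forall>\<^sub>F A in at (mat 1). det (A :: real^'n^'n) > 0"
    by (auto simp: isCont_def intro!: order_tendstoD(1)[where y = "1::real"])
  then have "\<forall>\<^sub>F A in at (mat 1). det A = \<bar>det (A :: real^'n^'n)\<bar>"
    by eventually_elim simp
  from has_derivative_transform_eventually[OF has_derivative_det_mat_1 this] show ?thesis
    by simp
qed

text \<open>The condition on \<open>H\<close> involves only its norm. Applied to
  \<open>H = - (\<epsilon> *\<^sub>R Dn y)\<close> with bounded \<open>Dn\<close>, this makes the
  error uniform in \<open>y\<close>.\<close>

lemma abs_det_approx:
  fixes e :: real
  assumes "e > 0"
  obtains d where "d > 0"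
    "\<And>H :: real^'n^'n. norm H < d \<Longrightarrow> \<bar>\<bar>det (mat 1 + H)\<bar> - 1 - trace H\<bar> \<le> e * norm H"
proof -
  obtain d where "d > 0" and d: "\<And>A :: real^'n^'n. norm (A - mat 1) < d \<Longrightarrow>
      norm (\<bar>det A\<bar> - \<bar>det (mat 1 :: real^'n^'n)\<bar> - trace (A - mat 1)) \<le> e * norm (A - mat 1)"
    using has_derivative_abs_det_mat_1[unfolded has_derivative_at_alt] \<open>e > 0\<close> by metis
  show thesis
    by (rule that[OF \<open>d > 0\<close>]) (use d[of "mat 1 + H" for H] in simp)
qed

section \<open>Unit vector fields and the inverse of the argmax map\<close>

lemma cball_subset_if_infdist_gt:
  assumes "infdist x (- \<Omega>) > a"
  shows "cball x a \<subseteq> \<Omega>"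
  using assms by (meson ComplI infdist_le mem_cball not_le order.strict_trans1 order.trans subsetI)

lemma inner_region_cball_subset:
  assumes "x \<in> inner_region \<Omega> a" shows "cball x a \<subseteq> \<Omega>"
  using assms by (intro cball_subset_if_infdist_gt) (simp add: inner_region_def)

lemma open_inner_region:
  assumes "open \<Omega>" shows "open (inner_region \<Omega> a)"
proof -
  have "open {x. infdist x (- \<Omega>) > a}"
    by (intro open_Collect_less continuous_intros)
  moreover have "inner_region \<Omega> a = \<Omega> \<inter> {x. infdist x (- \<Omega>) > a}"
    by (auto simp: inner_region_def)
  ultimately show ?thesis using assms by auto
qed

lemma inner_region_subset: "inner_region \<Omega> a \<subseteq> \<Omega>"
  by (auto simp: inner_region_def)

text \<open>The distance to the complement is 1-Lipschitz, so a move by at most \<open>b\<close>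
  loses at most \<open>b\<close> of depth.\<close>

lemma inner_region_shift:
  assumes "y \<in> inner_region \<Omega> (a + b)" "dist y x \<le> b" "a \<ge> 0"
  shows "x \<in> inner_region \<Omega> a"
proof -
  have "infdist y (- \<Omega>) \<le> infdist x (- \<Omega>) + dist y x"
    by (rule infdist_triangle)
  moreover have "infdist x (-\<Omega>) > 0 \<Longrightarrow> x \<in> \<Omega>"
    by (rule ccontr) simp
  ultimately show ?thesis using assms by (auto simp: inner_region_def)
qed

text \<open>A crude entrywise estimate, enough to turn a bound on the matrix norm into a Lipschitz
  constant.\<close>

lemma onorm_matrix_le:
  fixes A :: "real^'n^'m"
  shows "onorm ((*v) A) \<le> real CARD('m) * real CARD('n) * norm A"
  by (rule onorm_le_matrix_component) (meson Finite_Cartesian_Product.norm_nth_le order_trans component_le_norm_cart)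

locale unit_field =
  fixes \<Omega> :: "(real^'n::{finite,wellorder}) set" and n :: "real^'n::_ \<Rightarrow> real^'n::_"
    and Dn :: "real^'n::_ \<Rightarrow> real^'n::_^'n::_" and K :: real
  assumes open_domain: "open \<Omega>" and bounded_domain: "bounded \<Omega>"
    and norm_field: "x \<in> \<Omega> \<Longrightarrow> norm (n x) = 1"
    and field_deriv: "x \<in> \<Omega> \<Longrightarrow> (n has_derivative (\<lambda>h. Dn x *v h)) (at x)"
    and cont_Dn: "continuous_on \<Omega> Dn"
    and norm_Dn: "x \<in> \<Omega> \<Longrightarrow> norm (Dn x) \<le> K" and K_pos: "K > 0"
begin

definition L :: real where "L = real CARD('n) * real CARD('n) * K"

lemma L_pos: "L > 0"
  using K_pos by (simp add: L_def)

text \<open>The mean value inequality needs segments inside the domain. Since \<Omega> is not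
  assumed convex, the bound is stated on convex subsets, in practice closed balls.\<close>

lemma field_lipschitz:
  assumes "convex S" "S \<subseteq> \<Omega>" "x \<in> S" "y \<in> S"
  shows "norm (n x - n y) \<le> L * norm (x - y)"
proof (rule differentiable_bound[OF \<open>convex S\<close>, of n "\<lambda>x h. Dn x *v h"])
  fix x assume "x \<in> S"
  with assms have "x \<in> \<Omega>" by auto
  show "(n has_derivative (\<lambda>h. Dn x *v h)) (at x within S)"
    by (rule has_derivative_at_withinI[OF field_deriv[OF \<open>x \<in> \<Omega>\<close>]])
  have "onorm ((*v) (Dn x)) \<le> real CARD('n) * real CARD('n) * norm (Dn x)"
    by (rule onorm_matrix_le)
  also have "\<dots> \<le> L"
    unfolding L_def using norm_Dn[OF \<open>x \<in> \<Omega>\<close>] by (intro mult_left_mono) auto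
  finally show "onorm ((*v) (Dn x)) \<le> L" .
qed (use assms in auto)

lemma field_cont: "continuous_on \<Omega> n"
  using field_deriv by (meson continuous_at_imp_continuous_on has_derivative_continuous)

definition step :: "real \<Rightarrow> real^'n::_ \<Rightarrow> real^'n::_" where "step \<epsilon> y = y - \<epsilon> *\<^sub>R n y"

lemma dist_step: "y \<in> \<Omega> \<Longrightarrow> \<epsilon> \<ge> 0 \<Longrightarrow> dist y (step \<epsilon> y) = \<epsilon>"
  by (simp add: step_def dist_norm norm_field)

text \<open>\<open>step\<close> is the identity minus a map with Lipschitz constant
  \<open>\<epsilon> * L\<close>. Once \<open>\<epsilon> * L < 1\<close>, this gives both injectivity
  and a Lipschitz inverse.\<close>

lemma step_expansion:
  assumes "convex S" "S \<subseteq> \<Omega>" "x \<in> S" "y \<in> S" "\<epsilon> \<ge> 0"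
  shows "(1 - \<epsilon> * L) * norm (x - y) \<le> norm (step \<epsilon> x - step \<epsilon> y)"
proof -
  have "norm (x - y) = norm (step \<epsilon> x - step \<epsilon> y + \<epsilon> *\<^sub>R (n x - n y))"
    by (simp add: step_def algebra_simps)
  also have "\<dots> \<le> norm (step \<epsilon> x - step \<epsilon> y) + norm (\<epsilon> *\<^sub>R (n x - n y))"
    by (rule norm_triangle_ineq)
  also have "norm (\<epsilon> *\<^sub>R (n x - n y)) \<le> \<epsilon> * (L * norm (x - y))"
    using field_lipschitz[OF assms(1-4)] \<open>\<epsilon> \<ge> 0\<close> by (simp add: mult_left_mono)
  finally show ?thesis by (simp add: algebra_simps)
qed

lemma step_inj_convex:
  assumes "convex S" "S \<subseteq> \<Omega>" "x \<in> S" "y \<in> S" "\<epsilon> \<ge> 0" "\<epsilon> * L < 1" "step \<epsilon> x = step \<epsilon> y"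
  shows "x = y"
proof -
  have "(1 - \<epsilon> * L) * norm (x - y) \<le> 0"
    using step_expansion[OF assms(1-5)] assms(7) by simp
  then show ?thesis using assms(6) by (simp add: mult_le_0_iff)
qed

lemma step_in_inner_region:
  assumes "y \<in> inner_region \<Omega> (2 * \<epsilon>)" "\<epsilon> > 0"
  shows "step \<epsilon> y \<in> inner_region \<Omega> \<epsilon>"
proof (rule inner_region_shift)
  show "y \<in> inner_region \<Omega> (\<epsilon> + \<epsilon>)" using assms by simp
  show "dist y (step \<epsilon> y) \<le> \<epsilon>"
    using dist_step[of y \<epsilon>] assms subsetD[OF inner_region_subset assms(1)] by simp
qed (use assms in auto)

text \<open>Two points with a common image both have distance \<epsilon> from it, hence lie in one
  closed ball. Points of depth \<open>2 * \<epsilon>\<close> have images of depth \<epsilon>, so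
  this ball is inside \<Omega> and injectivity on convex sets applies.\<close>

lemma inj_on_step:
  assumes "\<epsilon> > 0" "\<epsilon> * L < 1"
  shows "inj_on (step \<epsilon>) (inner_region \<Omega> (2 * \<epsilon>))"
proof (rule inj_onI)
  fix y z assume y: "y \<in> inner_region \<Omega> (2 * \<epsilon>)" and z: "z \<in> inner_region \<Omega> (2 * \<epsilon>)"
    and eq: "step \<epsilon> y = step \<epsilon> z"
  have "y \<in> \<Omega>" "z \<in> \<Omega>" using y z inner_region_subset by auto
  then show "y = z"
    using dist_step[of y \<epsilon>] dist_step[of z \<epsilon>] assms eq
      inner_region_cball_subset[OF step_in_inner_region[OF y \<open>\<epsilon> > 0\<close>]]
    by (intro step_inj_convex[of "cball (step \<epsilon> y) \<epsilon>" y z \<epsilon>]) (auto simp: dist_commute)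
qed

lemma step_deriv:
  assumes "y \<in> \<Omega>"
  shows "(step \<epsilon> has_derivative (\<lambda>h. (mat 1 - \<epsilon> *\<^sub>R Dn y) *v h)) (at y)"
proof -
  have "((\<lambda>y. y - \<epsilon> *\<^sub>R n y) has_derivative (\<lambda>h. h - \<epsilon> *\<^sub>R (Dn y *v h))) (at y)"
    by (intro derivative_intros field_deriv assms)
  then show ?thesis
    by (simp add: step_def[abs_def] matrix_vector_mult_diff_rdistrib scaleR_matrix_vector_assoc)
qed

end

section \<open>Densities and the change of variables\<close>

text \<open>\<open>lebesgue\<close> is the completion of \<open>lborel\<close>, which does not
  affect integrability of Borel functions. This links the change of variables, stated over
  \<open>lebesgue\<close>, to densities over \<open>lborel\<close>.\<close>

lemma absolutely_integrable_iff_set_integrable_lborel: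
  fixes f :: "'a::euclidean_space \<Rightarrow> 'b::{banach, second_countable_topology}"
  assumes "(\<lambda>x. indicator A x *\<^sub>R f x) \<in> borel_measurable borel"
  shows "set_integrable lebesgue A f \<longleftrightarrow> set_integrable lborel A f"
  using assms unfolding set_integrable_def by (intro integrable_completion) simp

lemma set_integrable_bounded_density:
  fixes \<rho> :: "'a::euclidean_space \<Rightarrow> real"
  assumes "open \<Omega>" "bounded \<Omega>" "continuous_on \<Omega> \<rho>" "\<And>x. x \<in> \<Omega> \<Longrightarrow> \<bar>\<rho> x\<bar> \<le> B"
    and "A \<in> sets borel" "A \<subseteq> \<Omega>"
  shows "set_integrable lborel A \<rho>"
proof -
  have "set_integrable lborel \<Omega> \<rho>"
    unfolding set_integrable_def
  proof (rule Bochner_Integration.integrable_bound)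
    show "integrable lborel (\<lambda>x. B * indicator \<Omega> x)"
      using assms(1) emeasure_bounded_finite[OF assms(2)] by (intro integrable_mult_right) simp
    show "(\<lambda>x. indicator \<Omega> x *\<^sub>R \<rho> x) \<in> borel_measurable lborel"
      using borel_measurable_continuous_on_indicator[OF _ assms(3)] assms(1) by simp
    show "AE x in lborel. norm (indicator \<Omega> x *\<^sub>R \<rho> x) \<le> norm (B * indicator \<Omega> x)"
      using assms(4) by (intro AE_I2) (auto simp: indicator_def intro: order_trans[OF _ abs_ge_self])
  qed
  then show ?thesis by (rule set_integrable_subset) (use assms in auto)
qed

lemma measure_density_restrict:
  fixes \<rho> :: "'a::euclidean_space \<Rightarrow> real"
  assumes "open \<Omega>" "continuous_on \<Omega> \<rho>" "\<And>x. x \<in> \<Omega> \<Longrightarrow> 0 \<le> \<rho> x"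
    and "set_integrable lborel A \<rho>" "A \<in> sets borel" "A \<subseteq> \<Omega>"
    and \<nu>: "\<nu> = density (restrict_space lborel \<Omega>) (\<lambda>x. ennreal (\<rho> x))"
  shows "measure \<nu> A = (LINT x:A|lborel. \<rho> x)"
proof -
  have A: "A \<in> sets (restrict_space lborel \<Omega>)"
    using assms(1,5,6) by (simp add: sets_restrict_space_iff)
  have "(\<lambda>x. ennreal (\<rho> x)) \<in> borel_measurable (restrict_space borel \<Omega>)"
    using borel_measurable_continuous_on_restrict[OF assms(2)] by simp
  then have "(\<lambda>x. ennreal (\<rho> x)) \<in> borel_measurable (restrict_space lborel \<Omega>)"
    by (simp add: measurable_def space_restrict_space sets_restrict_space)
  then have "emeasure \<nu> A = (\<integral>\<^sup>+x. ennreal (\<rho> x) * indicator A x \<partial>restrict_space lborel \<Omega>)"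
    unfolding \<nu> using A by (rule emeasure_density)
  also have "\<dots> = (\<integral>\<^sup>+x. ennreal (\<rho> x) * indicator A x * indicator \<Omega> x \<partial>lborel)"
    using assms(1) by (intro nn_integral_restrict_space) simp
  also have "\<dots> = (\<integral>\<^sup>+x. ennreal (indicator A x *\<^sub>R \<rho> x) \<partial>lborel)"
    using assms(6) by (intro nn_integral_cong) (auto simp: indicator_def)
  also have "\<dots> = ennreal (LINT x:A|lborel. \<rho> x)"
    using assms(3,4,6) unfolding set_integrable_def set_lebesgue_integral_def
    by (intro nn_integral_eq_integral AE_I2) (auto simp: indicator_def)
  finally have "emeasure \<nu> A = ennreal (LINT x:A|lborel. \<rho> x)" .
  moreover have "0 \<le> (LINT x:A|lborel. \<rho> x)"
    using assms(3,6) unfolding set_lebesgue_integral_def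
    by (intro integral_nonneg_AE AE_I2) (auto simp: indicator_def)
  ultimately show ?thesis by (simp add: measure_def)
qed

text \<open>Reduces to the vector-valued theorem by identifying the reals with
  \<open>real^1\<close>.\<close>

lemma integral_change_of_variables_real_valued:
  fixes f :: "real^'m::{finite,wellorder} \<Rightarrow> real" and g :: "real^'m::_ \<Rightarrow> real^'m::_"
  assumes "S \<in> sets lebesgue" "\<And>x. x \<in> S \<Longrightarrow> (g has_derivative g' x) (at x)" "inj_on g S"
    and "f absolutely_integrable_on (g ` S)"
  shows "(\<lambda>x. \<bar>det (matrix (g' x))\<bar> * f (g x)) absolutely_integrable_on S"
    and "integral S (\<lambda>x. \<bar>det (matrix (g' x))\<bar> * f (g x)) = integral (g ` S) f"
proof -
  let ?F = "\<lambda>x. vec (f x) :: real^1"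
  have "?F absolutely_integrable_on (g ` S)"
    using assms(4) by (simp add: absolutely_integrable_on_1_iff)
  then have *: "(\<lambda>x. \<bar>det (matrix (g' x))\<bar> *\<^sub>R ?F (g x)) absolutely_integrable_on S \<and>
      integral S (\<lambda>x. \<bar>det (matrix (g' x))\<bar> *\<^sub>R ?F (g x)) = integral (g ` S) ?F"
    using has_absolute_integral_change_of_variables[OF assms(1) _ assms(3),
        where g' = g' and f = ?F and b = "integral (g ` S) ?F"]
      has_derivative_at_withinI[OF assms(2)] by blast
  then show "(\<lambda>x. \<bar>det (matrix (g' x))\<bar> * f (g x)) absolutely_integrable_on S"
    by (simp add: absolutely_integrable_on_1_iff)
  show "integral S (\<lambda>x. \<bar>det (matrix (g' x))\<bar> * f (g x)) = integral (g ` S) f"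
    using conjunct2[OF *] by (simp add: integral_on_1_eq vec_eq_iff)
qed

section \<open>Argmax maps and their pushforwards\<close>

text \<open>The gradient of \<open>u\<close> is split into its direction \<open>n\<close> and its
  length \<open>g\<close>, because only the direction determines maximizers over small balls.
  Negating \<open>u\<close> and \<open>n\<close> keeps \<open>g\<close>, so minimizers come from a
  second instance.\<close>

locale ascent_field = unit_field \<Omega> n Dn K
  for \<Omega> :: "(real^'n::{finite,wellorder}) set" and n Dn K +
  fixes u g :: "real^'n::_ \<Rightarrow> real"
  assumes u_deriv: "x \<in> \<Omega> \<Longrightarrow> GDERIV u x :> g x *\<^sub>R n x"
    and g_pos: "x \<in> \<Omega> \<Longrightarrow> g x > 0"
begin

text \<open>At a maximizer \<open>y\<close> no direction into the ball has positive derivative.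
  Testing with the point of the ball farthest along \<open>n y\<close> gives
  \<open>\<epsilon> \<le> (y - x) \<bullet> n y\<close>, while \<open>y - x\<close> has norm at most
  \<epsilon>. This is the equality case of Cauchy-Schwarz, so
  \<open>y - x = \<epsilon> *\<^sub>R n y\<close>; interior maximizers need no separate
  treatment.\<close>

lemma is_arg_max_imp_step:
  assumes sub: "cball x \<epsilon> \<subseteq> \<Omega>" and "\<epsilon> > 0" and max: "is_arg_max u (\<lambda>y. y \<in> cball x \<epsilon>) y"
  shows "step \<epsilon> y = x"
proof -
  have y: "y \<in> cball x \<epsilon>" and le: "\<And>z. z \<in> cball x \<epsilon> \<Longrightarrow> u z \<le> u y"
    using max by (auto simp: is_arg_max_def not_less)
  have "y \<in> \<Omega>" using y sub by auto
  \<comment> \<open>Among the points of the ball, \<open>z\<close> maximizes the inner product with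
    \<open>n y\<close>.\<close>
  define z where "z = x + \<epsilon> *\<^sub>R n y"
  have z: "z \<in> cball x \<epsilon>"
    using \<open>\<epsilon> > 0\<close> by (simp add: z_def dist_norm norm_field[OF \<open>y \<in> \<Omega>\<close>])
  have "(z - y) \<bullet> n y \<le> 0"
  proof (rule ccontr)
    assume pos: "\<not> (z - y) \<bullet> n y \<le> 0"
    let ?f = "\<lambda>t. u (y + t *\<^sub>R (z - y))"
    have "(u has_derivative (\<lambda>h. h \<bullet> (g y *\<^sub>R n y))) (at (y + 0 *\<^sub>R (z - y)))"
      using u_deriv[OF \<open>y \<in> \<Omega>\<close>] by (simp add: gderiv_def)
    moreover have "((\<lambda>t. y + t *\<^sub>R (z - y)) has_derivative (\<lambda>t. t *\<^sub>R (z - y))) (at 0)"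
      by (auto intro!: derivative_eq_intros)
    ultimately have "(?f has_derivative (\<lambda>t. (t *\<^sub>R (z - y)) \<bullet> (g y *\<^sub>R n y))) (at 0)"
      by (rule has_derivative_compose[rotated])
    then have "DERIV ?f 0 :> g y * ((z - y) \<bullet> n y)"
      unfolding has_field_derivative_def
      by (rule has_derivative_eq_rhs) (simp add: fun_eq_iff mult_ac)
    moreover have "g y * ((z - y) \<bullet> n y) > 0"
      using g_pos[OF \<open>y \<in> \<Omega>\<close>] pos by simp
    ultimately obtain d where "d > 0" and d: "\<And>h. 0 < h \<Longrightarrow> h < d \<Longrightarrow> ?f 0 < ?f (0 + h)"
      using DERIV_pos_inc_right by metis
    \<comment> \<open>Below \<open>d\<close>, so that \<open>u\<close> has increased strictly, and
      at most 1, so that the point stays on the segment from \<open>y\<close> to \<open>z\<close>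
      and hence in the ball.\<close>
    define t where "t = min (d / 2) 1"
    have "0 < t" "t < d" "t \<le> 1" using \<open>d > 0\<close> by (auto simp: t_def)
    have "y + t *\<^sub>R (z - y) = (1 - t) *\<^sub>R y + t *\<^sub>R z"
      by (simp add: algebra_simps)
    then have "y + t *\<^sub>R (z - y) \<in> cball x \<epsilon>"
      using convexD[OF convex_cball y z, of "1 - t" t] \<open>0 < t\<close> \<open>t \<le> 1\<close> by simp
    with le have "?f t \<le> ?f 0" by simp
    with d[OF \<open>0 < t\<close> \<open>t < d\<close>] show False by simp
  qed
  then have "\<epsilon> \<le> (y - x) \<bullet> n y"
    using norm_field[OF \<open>y \<in> \<Omega>\<close>]
    by (simp add: z_def inner_diff_left inner_add_left dot_square_norm)
  then have "\<epsilon> * \<epsilon> \<le> \<epsilon> * ((y - x) \<bullet> n y)"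
    using \<open>\<epsilon> > 0\<close> by (intro mult_left_mono) auto
  moreover have "(norm (y - x))\<^sup>2 \<le> \<epsilon>\<^sup>2"
    using y by (intro power_mono) (auto simp: dist_norm norm_minus_commute)
  \<comment> \<open>Expanding the square: with the two previous bounds the right-hand side is at
    most \<open>\<epsilon>\<^sup>2 - 2 * \<epsilon>\<^sup>2 + \<epsilon>\<^sup>2 =
    0\<close>.\<close>
  moreover have "(norm (y - x - \<epsilon> *\<^sub>R n y))\<^sup>2 = (norm (y - x))\<^sup>2 - 2 * (\<epsilon> * ((y - x) \<bullet> n y)) + \<epsilon>\<^sup>2"
  proof -
    have "(norm (v - \<epsilon> *\<^sub>R n y))\<^sup>2 = (norm v)\<^sup>2 - 2 * (\<epsilon> * (v \<bullet> n y)) + \<epsilon>\<^sup>2 * (n y \<bullet> n y)" for v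
      unfolding power2_norm_eq_inner
      by (simp add: inner_diff_left inner_diff_right inner_commute power2_eq_square)
    then show ?thesis by (simp add: dot_square_norm norm_field[OF \<open>y \<in> \<Omega>\<close>])
  qed
  ultimately have "(norm (y - x - \<epsilon> *\<^sub>R n y))\<^sup>2 \<le> 0"
    by (simp add: power2_eq_square)
  then show ?thesis by (simp add: step_def algebra_simps)
qed

lemma closure_ball_Int:
  assumes "x \<in> inner_region \<Omega> \<epsilon>" "\<epsilon> > 0"
  shows "closure (ball x \<epsilon> \<inter> \<Omega>) = cball x \<epsilon>"
proof -
  have "ball x \<epsilon> \<inter> \<Omega> = ball x \<epsilon>"
    using inner_region_cball_subset[OF assms(1)] ball_subset_cball[of x \<epsilon>] by blast
  then show ?thesis using assms(2) by simp
qed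

text \<open>Existence is compactness of the closed ball. For uniqueness, \<open>step\<close> sends
  every maximizer to the center \<open>x\<close> and is injective on the ball.\<close>

lemma ex1_arg_max:
  assumes "x \<in> inner_region \<Omega> \<epsilon>" "\<epsilon> > 0" "\<epsilon> * L < 1"
  shows "\<exists>!y. is_arg_max u (\<lambda>y. y \<in> closure (ball x \<epsilon> \<inter> \<Omega>)) y"
proof -
  note sub = inner_region_cball_subset[OF assms(1)]
  have "continuous_on (cball x \<epsilon>) u"
    using u_deriv sub unfolding gderiv_def
    by (meson continuous_at_imp_continuous_on has_derivative_continuous subsetD)
  then obtain y where y: "y \<in> cball x \<epsilon>" "\<forall>z\<in>cball x \<epsilon>. u z \<le> u y"
    using continuous_attains_sup[OF compact_cball, of x \<epsilon> u] \<open>\<epsilon> > 0\<close> by auto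
  show ?thesis
    unfolding closure_ball_Int[OF assms(1,2)]
  proof (rule ex1I)
    show max: "is_arg_max u (\<lambda>y. y \<in> cball x \<epsilon>) y"
      using y by (auto simp: is_arg_max_def not_less)
    fix z assume z: "is_arg_max u (\<lambda>y. y \<in> cball x \<epsilon>) z"
    then have "z \<in> cball x \<epsilon>" by (simp add: is_arg_max_def)
    then show "z = y"
      using is_arg_max_imp_step[OF sub \<open>\<epsilon> > 0\<close> z] is_arg_max_imp_step[OF sub \<open>\<epsilon> > 0\<close> max]
        y(1) assms sub by (intro step_inj_convex[of "cball x \<epsilon>" z y \<epsilon>]) auto
  qed
qed

lemma ball_argmax_props:
  assumes "x \<in> inner_region \<Omega> \<epsilon>" "\<epsilon> > 0" "\<epsilon> * L < 1"
  shows "ball_argmax \<Omega> u \<epsilon> x \<in> cball x \<epsilon>" "step \<epsilon> (ball_argmax \<Omega> u \<epsilon> x) = x"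
proof -
  \<comment> \<open>\<open>arg_max\<close> is a choice operator, so existence of a maximizer has to
    be supplied before its value is known to be one.\<close>
  have max: "is_arg_max u (\<lambda>y. y \<in> cball x \<epsilon>) (ball_argmax \<Omega> u \<epsilon> x)"
    using someI_ex[OF ex1_implies_ex[OF ex1_arg_max[OF assms]]]
    by (simp add: ball_argmax_def arg_max_def closure_ball_Int[OF assms(1,2)])
  then show "ball_argmax \<Omega> u \<epsilon> x \<in> cball x \<epsilon>" by (simp add: is_arg_max_def)
  show "step \<epsilon> (ball_argmax \<Omega> u \<epsilon> x) = x"
    by (rule is_arg_max_imp_step[OF inner_region_cball_subset[OF assms(1)] assms(2) max])
qed

text \<open>Depth \<open>2 * \<epsilon>\<close> puts the closed ball around
  \<open>step \<epsilon> y\<close> inside \<Omega>. Both \<open>y\<close> and the maximizer lie in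
  it and have the same image under \<open>step\<close>.\<close>

lemma ball_argmax_step:
  assumes "y \<in> inner_region \<Omega> (2 * \<epsilon>)" "\<epsilon> > 0" "\<epsilon> * L < 1"
  shows "ball_argmax \<Omega> u \<epsilon> (step \<epsilon> y) = y"
proof -
  note x = step_in_inner_region[OF assms(1,2)]
  have "y \<in> \<Omega>" using assms(1) inner_region_subset by blast
  then show ?thesis
    using ball_argmax_props[OF x assms(2,3)] inner_region_cball_subset[OF x]
      dist_step[of y \<epsilon>] assms
    by (intro step_inj_convex[of "cball (step \<epsilon> y) \<epsilon>" "ball_argmax \<Omega> u \<epsilon> (step \<epsilon> y)" y \<epsilon>])
      (simp_all add: dist_commute)
qed

text \<open>Turns the preimages occurring in the pushforward into images of an explicit
  differentiable map, the form needed for the change of variables.\<close>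

lemma vimage_ball_argmax:
  assumes "A \<subseteq> inner_region \<Omega> (2 * \<epsilon>)" "\<epsilon> > 0" "\<epsilon> * L < 1"
  shows "ball_argmax \<Omega> u \<epsilon> -` A \<inter> inner_region \<Omega> \<epsilon> = step \<epsilon> ` A"
proof (intro equalityI subsetI)
  fix x assume "x \<in> ball_argmax \<Omega> u \<epsilon> -` A \<inter> inner_region \<Omega> \<epsilon>"
  then show "x \<in> step \<epsilon> ` A"
    using ball_argmax_props(2)[of x \<epsilon>] assms(2,3) by (metis IntE imageI vimageE)
next
  fix x assume "x \<in> step \<epsilon> ` A"
  then obtain y where "y \<in> A" "x = step \<epsilon> y" by blast
  then show "x \<in> ball_argmax \<Omega> u \<epsilon> -` A \<inter> inner_region \<Omega> \<epsilon>"
    using ball_argmax_step[of y \<epsilon>] step_in_inner_region[of y \<epsilon>] assms by auto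
qed

text \<open>By \<open>step_expansion\<close> the inverse of \<open>step\<close> is Lipschitz on any
  ball inside \<Omega>; it remains to find one ball containing the maximizers for all nearby
  centers.\<close>

lemma continuous_on_ball_argmax:
  assumes "\<epsilon> > 0" "\<epsilon> * L < 1"
  shows "continuous_on (inner_region \<Omega> \<epsilon>) (ball_argmax \<Omega> u \<epsilon>)"
  unfolding continuous_on_iff
proof (intro ballI allI impI)
  fix x e assume x: "x \<in> inner_region \<Omega> \<epsilon>" and "(e::real) > 0"
  let ?G = "ball_argmax \<Omega> u \<epsilon>"
  \<comment> \<open>Half of the spare depth at \<open>x\<close>. If the center moves by less than
    \<open>r\<close>, its maximizer stays in \<open>cball x (\<epsilon> + r)\<close>, which is still
    inside \<Omega>.\<close>
  define r where "r = (infdist x (- \<Omega>) - \<epsilon>) / 2"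
  have "r > 0" "\<epsilon> + r < infdist x (- \<Omega>)"
    using x by (auto simp: r_def inner_region_def field_simps)
  define d where "d = min r (e * (1 - \<epsilon> * L))"
  have "d > 0" using \<open>r > 0\<close> \<open>e > 0\<close> assms by (simp add: d_def)
  have sub: "cball x (\<epsilon> + r) \<subseteq> \<Omega>"
    by (rule cball_subset_if_infdist_gt) fact
  have "dist (?G x') (?G x) < e" if x': "x' \<in> inner_region \<Omega> \<epsilon>" and "dist x' x < d" for x'
  proof -
    have "dist x (?G x') \<le> dist x x' + dist x' (?G x')" by (rule dist_triangle)
    also have "\<dots> \<le> \<epsilon> + r"
      using ball_argmax_props(1)[OF x' assms] that(2) by (simp add: d_def dist_commute)
    finally have "?G x' \<in> cball x (\<epsilon> + r)" by simp
    moreover have "?G x \<in> cball x (\<epsilon> + r)"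
      using ball_argmax_props(1)[OF x assms] \<open>r > 0\<close> by simp
    ultimately have "(1 - \<epsilon> * L) * norm (?G x' - ?G x) \<le> norm (step \<epsilon> (?G x') - step \<epsilon> (?G x))"
      using assms sub by (intro step_expansion[OF convex_cball]) auto
    also have "\<dots> = dist x' x"
      by (simp add: ball_argmax_props(2) x x' assms dist_norm)
    also have "\<dots> < e * (1 - \<epsilon> * L)" using that(2) by (simp add: d_def)
    finally show ?thesis using assms(2) by (simp add: dist_norm mult.commute)
  qed
  with \<open>d > 0\<close> show "\<exists>d>0. \<forall>x'\<in>inner_region \<Omega> \<epsilon>. dist x' x < d \<longrightarrow> dist (?G x') (?G x) < e"
    by blast
qed

lemma borel_measurable_ball_argmax:
  assumes "\<epsilon> > 0" "\<epsilon> * L < 1"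
  shows "ball_argmax \<Omega> u \<epsilon> \<in> borel_measurable (restrict_space borel (inner_region \<Omega> \<epsilon>))"
  by (rule borel_measurable_continuous_on_restrict[OF continuous_on_ball_argmax[OF assms]])

definition push_density :: "(real^'n::_ \<Rightarrow> real) \<Rightarrow> real \<Rightarrow> real^'n::_ \<Rightarrow> real" where
  "push_density \<rho> \<epsilon> y = \<bar>det (mat 1 - \<epsilon> *\<^sub>R Dn y)\<bar> * \<rho> (step \<epsilon> y)"

lemma continuous_on_push_density:
  assumes "continuous_on \<Omega> \<rho>" "\<epsilon> > 0"
  shows "continuous_on (inner_region \<Omega> (2 * \<epsilon>)) (push_density \<rho> \<epsilon>)"
proof -
  let ?S = "inner_region \<Omega> (2 * \<epsilon>)"
  have "continuous_on ?S n" "continuous_on ?S Dn"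
    by (rule continuous_on_subset[OF _ inner_region_subset], rule field_cont cont_Dn)+
  moreover have "continuous_on ?S (\<lambda>y. \<rho> (step \<epsilon> y))"
  proof (rule continuous_on_compose2[OF assms(1)])
    show "continuous_on ?S (step \<epsilon>)"
      unfolding step_def by (intro continuous_intros) fact
    show "step \<epsilon> ` ?S \<subseteq> \<Omega>"
      using step_in_inner_region[OF _ \<open>\<epsilon> > 0\<close>] inner_region_subset by fast
  qed
  ultimately show ?thesis
    unfolding push_density_def det_def by (intro continuous_intros)
qed

lemma push_from_density:
  assumes \<nu>: "\<nu> = density (restrict_space lborel \<Omega>) (\<lambda>x. ennreal (\<rho> x))"
    and \<rho>: "continuous_on \<Omega> \<rho>" "\<And>x. x \<in> \<Omega> \<Longrightarrow> 0 \<le> \<rho> x" "\<And>x. x \<in> \<Omega> \<Longrightarrow> \<rho> x \<le> B"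
    and \<epsilon>: "\<epsilon> > 0" "\<epsilon> * L < 1"
  shows "has_lebesgue_density_on (measure (push_from (inner_region \<Omega> \<epsilon>) (ball_argmax \<Omega> u \<epsilon>) \<nu>))
    (push_density \<rho> \<epsilon>) (inner_region \<Omega> (2 * \<epsilon>))"
proof -
  let ?S = "inner_region \<Omega> \<epsilon>" and ?T = "inner_region \<Omega> (2 * \<epsilon>)"
  let ?\<Gamma> = "ball_argmax \<Omega> u \<epsilon>" and ?p = "push_density \<rho> \<epsilon>"
  have borel: "?S \<in> sets borel" "?T \<in> sets borel"
    using open_inner_region[OF open_domain] by auto
  have sub: "?S \<subseteq> \<Omega>" "?T \<subseteq> \<Omega>" by (rule inner_region_subset)+
  have meas: "(\<lambda>x. indicator A x *\<^sub>R ?p x) \<in> borel_measurable borel"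
    if "A \<in> sets borel" "A \<subseteq> ?T" for A
    using borel_measurable_continuous_on_indicator[OF that(1)
        continuous_on_subset[OF continuous_on_push_density[OF \<rho>(1) \<epsilon>(1)] that(2)]] by simp
  have sets_\<nu>: "sets \<nu> = sets (restrict_space borel \<Omega>)" "space \<nu> = \<Omega>"
    by (simp_all add: \<nu> sets_restrict_space space_restrict_space)
  have sets_\<nu>S: "sets (restrict_space \<nu> ?S) = sets (restrict_space borel ?S)"
    using sub by (simp add: sets_restrict_space_cong[OF sets_\<nu>(1)] sets_restrict_restrict_space Int_absorb1)
  have space_\<nu>S: "space (restrict_space \<nu> ?S) = ?S"
    using sub by (simp add: space_restrict_space sets_\<nu> Int_absorb2)
  have \<Gamma>: "?\<Gamma> \<in> measurable (restrict_space \<nu> ?S) borel"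
    using borel_measurable_ball_argmax[OF \<epsilon>] by (simp add: measurable_cong_sets[OF sets_\<nu>S refl])
  have main: "set_integrable lborel A ?p \<and>
      measure (push_from ?S ?\<Gamma> \<nu>) A = (LINT x:A|lborel. ?p x)"
    if A: "A \<in> sets borel" "A \<subseteq> ?T" for A
  proof -
    have img: "?\<Gamma> -` A \<inter> ?S = step \<epsilon> ` A"
      by (rule vimage_ball_argmax[OF A(2) \<epsilon>])
    \<comment> \<open>The image of \<open>A\<close> under \<open>step\<close> is Borel because it is
      a preimage under the measurable argmax map.\<close>
    have "?\<Gamma> -` A \<inter> ?S \<in> sets (restrict_space borel ?S)"
      using measurable_sets[OF \<Gamma> A(1)] space_\<nu>S sets_\<nu>S by simp
    then have img_borel: "step \<epsilon> ` A \<in> sets borel"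
      using borel by (simp add: img sets_restrict_space_iff)
    have img_sub: "step \<epsilon> ` A \<subseteq> ?S" using img by blast
    have int: "set_integrable lborel (step \<epsilon> ` A) \<rho>"
      using \<rho> img_sub sub img_borel
      by (intro set_integrable_bounded_density[OF open_domain bounded_domain \<rho>(1), of B]) auto
    have "(\<lambda>x. indicator (step \<epsilon> ` A) x *\<^sub>R \<rho> x) \<in> borel_measurable borel"
      using int unfolding set_integrable_def by (auto dest: borel_measurable_integrable)
    with int have abs_int: "\<rho> absolutely_integrable_on (step \<epsilon> ` A)"
      by (simp add: absolutely_integrable_iff_set_integrable_lborel)
    have A_leb: "A \<in> sets lebesgue" using A(1) by simp
    have der: "x \<in> A \<Longrightarrow> (step \<epsilon> has_derivative (\<lambda>h. (mat 1 - \<epsilon> *\<^sub>R Dn x) *v h)) (at x)" for x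
      using A(2) sub by (intro step_deriv) auto
    note cov = integral_change_of_variables_real_valued[OF A_leb der
        inj_on_subset[OF inj_on_step[OF \<epsilon>] A(2)] abs_int, unfolded matrix_of_matrix_vector_mul,
        folded push_density_def]
    have p_int: "set_integrable lborel A ?p"
      using cov(1) absolutely_integrable_iff_set_integrable_lborel[OF meas[OF A]] by blast
    have "measure (push_from ?S ?\<Gamma> \<nu>) A = measure (restrict_space \<nu> ?S) (step \<epsilon> ` A)"
      unfolding push_from_def by (simp add: measure_distr[OF \<Gamma> A(1)] space_\<nu>S img)
    also have "\<dots> = measure \<nu> (step \<epsilon> ` A)"
      using img_sub sub borel
      by (intro measure_restrict_space) (auto simp: sets_\<nu> sets_restrict_space_iff open_domain Int_absorb2)
    also have "\<dots> = (LINT x:step \<epsilon> ` A|lborel. \<rho> x)"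
      using img_sub sub by (intro measure_density_restrict[OF open_domain \<rho>(1,2) int img_borel _ \<nu>]) auto
    also have "\<dots> = (LINT x:A|lborel. ?p x)"
      using cov(2) by (simp add: set_borel_integral_eq_integral[OF int] set_borel_integral_eq_integral[OF p_int])
    finally show ?thesis using p_int by blast
  qed
  show ?thesis
    unfolding has_lebesgue_density_on_def
    using main[OF borel(2) order_refl] main by auto
qed

end

section \<open>Expansion of the pushforward density\<close>

lemma has_lebesgue_density_on_integrable:
  assumes "has_lebesgue_density_on \<nu> f S" "A \<in> sets borel" "A \<subseteq> S"
  shows "set_integrable lborel A f"
  using assms unfolding has_lebesgue_density_on_def by (auto intro: set_integrable_subset)

lemma has_lebesgue_density_on_add:
  assumes "has_lebesgue_density_on \<nu> f S" "has_lebesgue_density_on \<nu>' g S"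
  shows "has_lebesgue_density_on (\<lambda>A. \<nu> A + \<nu>' A) (\<lambda>x. f x + g x) S"
  using assms has_lebesgue_density_on_integrable[OF assms(1)] has_lebesgue_density_on_integrable[OF assms(2)]
  by (auto simp: has_lebesgue_density_on_def set_integral_add)

lemma has_lebesgue_density_on_diff:
  assumes "has_lebesgue_density_on \<nu> f S" "has_lebesgue_density_on \<nu>' g S"
  shows "has_lebesgue_density_on (\<lambda>A. \<nu> A - \<nu>' A) (\<lambda>x. f x - g x) S"
  using assms has_lebesgue_density_on_integrable[OF assms(1)] has_lebesgue_density_on_integrable[OF assms(2)]
  by (auto simp: has_lebesgue_density_on_def set_integral_diff)

lemma has_lebesgue_density_on_divide:
  assumes "has_lebesgue_density_on \<nu> f S"
  shows "has_lebesgue_density_on (\<lambda>A. \<nu> A / c) (\<lambda>x. f x / c) S"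
  using assms by (auto simp: has_lebesgue_density_on_def)

lemma onorm_inner_left_diff_le:
  "onorm (\<lambda>h. h \<bullet> a - h \<bullet> b) \<le> norm (a - b)" for a b :: "'a::real_inner"
  by (rule onorm_bound) (simp, metis Cauchy_Schwarz_ineq2 inner_diff_right mult.commute real_norm_def)

lemma abs_trace_le: "\<bar>trace A\<bar> \<le> real CARD('n) * norm A" for A :: "real^'n^'n"
proof -
  have "\<bar>A $ i $ i\<bar> \<le> norm A" for i
    by (meson Finite_Cartesian_Product.norm_nth_le component_le_norm_cart order_trans)
  then show ?thesis
    unfolding trace_def by (intro order_trans[OF sum_abs] sum_bounded_above)
qed

text \<open>The product rule: the derivative is a multiple of \<open>A\<close> plus a rank-one map,
  whose trace is the inner product of \<open>Dr\<close> with the field.\<close>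

lemma divergence_scaleR:
  fixes n :: "real^'n \<Rightarrow> real^'n"
  assumes "GDERIV r x :> Dr" "(n has_derivative (\<lambda>h. A *v h)) (at x)"
  shows "divergence (\<lambda>x. r x *\<^sub>R n x) x = Dr \<bullet> n x + r x * trace A"
proof -
  have "((\<lambda>x. r x *\<^sub>R n x) has_derivative (\<lambda>h. r x *\<^sub>R (A *v h) + (h \<bullet> Dr) *\<^sub>R n x)) (at x)"
    using assms unfolding gderiv_def by (intro has_derivative_scaleR)
  then have "divergence (\<lambda>x. r x *\<^sub>R n x) x =
      trace (matrix (\<lambda>h. r x *\<^sub>R (A *v h) + (h \<bullet> Dr) *\<^sub>R n x))"
    by (simp add: divergence_def jacobian_def frechet_derivative_at[symmetric])
  also have "\<dots> = (\<Sum>i\<in>UNIV. r x * A $ i $ i + Dr $ i * n x $ i)"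
    by (simp add: trace_def matrix_def matrix_vector_mult_basis column_def inner_axis')
  also have "\<dots> = Dr \<bullet> n x + r x * trace A"
    by (simp add: sum.distrib sum_distrib_left trace_def inner_vec_def)
  finally show ?thesis .
qed

context ascent_field
begin

text \<open>With \<open>z = step \<epsilon> y\<close>, the error times \<epsilon> splits into three
  parts: the determinant remainder times \<open>\<rho> z\<close>, the Taylor remainder of \<rho> at
  \<open>y\<close>, and the cost of exchanging \<open>\<rho> z\<close> for \<open>\<rho> y\<close>
  before the trace. Each is at most \<open>\<epsilon> * (\<eta> / 4)\<close>. The set
  \<open>S\<close> is where the gradient of \<rho> is uniformly continuous.\<close>

lemma push_density_expansion:
  assumes \<rho>: "\<And>x. x \<in> \<Omega> \<Longrightarrow> GDERIV \<rho> x :> D\<rho> x" "\<And>x. x \<in> \<Omega> \<Longrightarrow> \<bar>\<rho> x\<bar> \<le> B"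
    and S: "S \<subseteq> \<Omega>" "uniformly_continuous_on S D\<rho>" and "B > 0" "\<eta> > 0"
  obtains d where "d > 0" "\<And>\<epsilon> y. 0 < \<epsilon> \<Longrightarrow> \<epsilon> < d \<Longrightarrow> cball y \<epsilon> \<subseteq> S \<Longrightarrow>
    \<bar>(push_density \<rho> \<epsilon> y - \<rho> y) / \<epsilon> + (D\<rho> y \<bullet> n y + \<rho> y * trace (Dn y))\<bar> < \<eta>"
proof -
  have "bounded S" using bounded_domain S(1) bounded_subset by blast
  then have "bounded (D\<rho> ` S)"
    by (rule bounded_uniformly_continuous_image[OF S(2)])
  then obtain M where "M > 0" and M: "\<And>x. x \<in> S \<Longrightarrow> norm (D\<rho> x) \<le> M"
    by (auto simp: bounded_pos)
  define T where "T = real CARD('n) * K"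
  have "T > 0" using K_pos by (simp add: T_def)
  have T: "\<bar>trace (Dn x)\<bar> \<le> T" if "x \<in> \<Omega>" for x
    using abs_trace_le[of "Dn x"] norm_Dn[OF that] unfolding T_def
    by (meson mult_left_mono of_nat_0_le_iff order_trans)
  \<comment> \<open>Chosen so that the factors \<open>norm H \<le> \<epsilon> * K\<close> and
    \<open>\<bar>\<rho> z\<bar> \<le> B\<close> bring the determinant error to
    \<open>\<epsilon> * (\<eta> / 4)\<close>.\<close>
  have "\<eta> / (4 * B * K) > 0" using assms K_pos by simp
  then obtain d1 where "d1 > 0" and d1: "\<And>H :: real^'n::_^'n::_. norm H < d1 \<Longrightarrow>
      \<bar>\<bar>det (mat 1 + H)\<bar> - 1 - trace H\<bar> \<le> \<eta> / (4 * B * K) * norm H"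
    using abs_det_approx by blast
  obtain d2 where "d2 > 0" and d2: "\<And>x y. x \<in> S \<Longrightarrow> y \<in> S \<Longrightarrow> dist x y < d2 \<Longrightarrow> dist (D\<rho> x) (D\<rho> y) < \<eta> / 4"
    using S(2) \<open>\<eta> > 0\<close> unfolding uniformly_continuous_on_def by (metis divide_pos_pos zero_less_numeral)
  \<comment> \<open>One bound for each part of the error: determinant expansion, oscillation of the
    gradient, and size of \<open>\<epsilon> * (M * T)\<close>.\<close>
  define d where "d = min (d1 / K) (min d2 (\<eta> / (4 * M * T)))"
  have "d > 0"
    using \<open>d1 > 0\<close> \<open>d2 > 0\<close> K_pos \<open>M > 0\<close> \<open>T > 0\<close> \<open>\<eta> > 0\<close> by (simp add: d_def)
  moreover have "\<bar>(push_density \<rho> \<epsilon> y - \<rho> y) / \<epsilon> + (D\<rho> y \<bullet> n y + \<rho> y * trace (Dn y))\<bar> < \<eta>"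
    if "0 < \<epsilon>" "\<epsilon> < d" and sub: "cball y \<epsilon> \<subseteq> S" for \<epsilon> y
  proof -
    have \<epsilon>: "\<epsilon> * K < d1" "\<epsilon> < d2" "\<epsilon> * (M * T) < \<eta> / 4"
      using \<open>\<epsilon> < d\<close> K_pos \<open>M > 0\<close> \<open>T > 0\<close> by (auto simp: d_def field_simps)
    have "y \<in> S" using sub \<open>0 < \<epsilon>\<close> by auto
    then have "y \<in> \<Omega>" using S(1) by auto
    define z where "z = step \<epsilon> y"
    have zy: "z - y = - (\<epsilon> *\<^sub>R n y)" by (simp add: z_def step_def)
    have "z \<in> cball y \<epsilon>" using dist_step[OF \<open>y \<in> \<Omega>\<close>, of \<epsilon>] \<open>0 < \<epsilon>\<close> by (simp add: z_def)
    then have "z \<in> \<Omega>" using sub S(1) by auto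
    have nzy: "norm (z - y) = \<epsilon>" using norm_field[OF \<open>y \<in> \<Omega>\<close>] \<open>0 < \<epsilon>\<close> by (simp add: zy)
    have \<rho>_der: "(\<rho> has_derivative (\<lambda>h. h \<bullet> D\<rho> x)) (at x within cball y \<epsilon>)" if "x \<in> cball y \<epsilon>" for x
      using \<rho>(1)[of x] that sub S(1) unfolding gderiv_def by (blast intro: has_derivative_at_withinI)
    define \<Delta> where "\<Delta> = \<bar>det (mat 1 - \<epsilon> *\<^sub>R Dn y)\<bar>"
    have H: "norm (- (\<epsilon> *\<^sub>R Dn y)) \<le> \<epsilon> * K"
      using norm_Dn[OF \<open>y \<in> \<Omega>\<close>] \<open>0 < \<epsilon>\<close> by simp
    have trH: "trace (- (\<epsilon> *\<^sub>R Dn y)) = - (\<epsilon> * trace (Dn y))"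
      by (simp add: trace_def sum_negf sum_distrib_left)
    have "\<bar>\<Delta> - 1 + \<epsilon> * trace (Dn y)\<bar> \<le> \<eta> / (4 * B * K) * norm (- (\<epsilon> *\<^sub>R Dn y))"
      using d1[of "- (\<epsilon> *\<^sub>R Dn y)"] H \<epsilon>(1) by (simp only: \<Delta>_def trH) simp
    also have "\<dots> \<le> \<eta> / (4 * B * K) * (\<epsilon> * K)"
      using H \<open>\<eta> / (4 * B * K) > 0\<close> by (intro mult_left_mono) auto
    also have "\<dots> = \<epsilon> * (\<eta> / (4 * B))" using K_pos by simp
    finally have 1: "\<bar>\<Delta> - 1 + \<epsilon> * trace (Dn y)\<bar> \<le> \<epsilon> * (\<eta> / (4 * B))" .
    have "\<bar>\<rho> z * (\<Delta> - 1 + \<epsilon> * trace (Dn y))\<bar> \<le> B * (\<epsilon> * (\<eta> / (4 * B)))"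
      unfolding abs_mult using \<rho>(2)[OF \<open>z \<in> \<Omega>\<close>] 1 \<open>B > 0\<close> by (intro mult_mono) auto
    then have t1: "\<bar>\<rho> z * (\<Delta> - 1 + \<epsilon> * trace (Dn y))\<bar> \<le> \<epsilon> * (\<eta> / 4)"
      using \<open>B > 0\<close> by simp
    \<comment> \<open>The Taylor remainder is controlled by the oscillation of the gradient over the
      ball, so no second derivative of \<rho> enters.\<close>
    have "norm (\<rho> z - \<rho> y - (z - y) \<bullet> D\<rho> y) \<le> norm (z - y) * (\<eta> / 4)"
    proof (rule differentiable_bound_linearization[where S = "cball y \<epsilon>" and f' = "\<lambda>x h. h \<bullet> D\<rho> x"])
      show "y + t *\<^sub>R (z - y) \<in> cball y \<epsilon>" if "t \<in> {0..1}" for t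
        using that nzy \<open>0 < \<epsilon>\<close> by (simp add: dist_norm)
      fix x assume x: "x \<in> cball y \<epsilon>"
      then have "dist (D\<rho> x) (D\<rho> y) < \<eta> / 4"
        using sub \<epsilon>(2) \<open>y \<in> S\<close> by (intro d2) (auto simp: dist_commute)
      then show "onorm ((\<lambda>h. h \<bullet> D\<rho> x) - (\<lambda>h. h \<bullet> D\<rho> y)) \<le> \<eta> / 4"
        using onorm_inner_left_diff_le[of "D\<rho> x" "D\<rho> y"] by (simp add: fun_diff_def dist_norm)
    qed (use \<rho>_der \<open>0 < \<epsilon>\<close> in auto)
    then have t2: "\<bar>\<rho> z - \<rho> y + \<epsilon> * (D\<rho> y \<bullet> n y)\<bar> \<le> \<epsilon> * (\<eta> / 4)"
      unfolding nzy by (simp add: zy inner_commute)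
    have "norm (\<rho> y - \<rho> z) \<le> M * norm (y - z)"
    proof (rule differentiable_bound[OF convex_cball \<rho>_der])
      fix x assume "x \<in> cball y \<epsilon>"
      then show "onorm (\<lambda>h. h \<bullet> D\<rho> x) \<le> M"
        using onorm_inner_left_diff_le[of "D\<rho> x" 0] M[of x] sub by auto
    qed (use \<open>z \<in> cball y \<epsilon>\<close> \<open>0 < \<epsilon>\<close> in auto)
    then have "\<bar>\<rho> y - \<rho> z\<bar> \<le> M * \<epsilon>"
      using nzy by (simp add: norm_minus_commute)
    then have "\<bar>\<rho> y - \<rho> z\<bar> * \<bar>trace (Dn y)\<bar> \<le> (M * \<epsilon>) * T"
      using T[OF \<open>y \<in> \<Omega>\<close>] \<open>M > 0\<close> \<open>0 < \<epsilon>\<close> by (intro mult_mono) auto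
    then have "\<epsilon> * \<bar>(\<rho> y - \<rho> z) * trace (Dn y)\<bar> \<le> \<epsilon> * (\<epsilon> * (M * T))"
      using \<open>0 < \<epsilon>\<close> by (simp add: abs_mult mult_ac)
    also have "\<dots> < \<epsilon> * (\<eta> / 4)"
      using \<epsilon>(3) \<open>0 < \<epsilon>\<close> by simp
    finally have t3: "\<bar>\<epsilon> * ((\<rho> y - \<rho> z) * trace (Dn y))\<bar> < \<epsilon> * (\<eta> / 4)"
      using \<open>0 < \<epsilon>\<close> by (simp add: abs_mult)
    have "\<epsilon> * ((push_density \<rho> \<epsilon> y - \<rho> y) / \<epsilon> + (D\<rho> y \<bullet> n y + \<rho> y * trace (Dn y))) =
        \<rho> z * (\<Delta> - 1 + \<epsilon> * trace (Dn y)) + (\<rho> z - \<rho> y + \<epsilon> * (D\<rho> y \<bullet> n y)) +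
        \<epsilon> * ((\<rho> y - \<rho> z) * trace (Dn y))"
    proof -
      have "\<epsilon> * ((push_density \<rho> \<epsilon> y - \<rho> y) / \<epsilon>) = \<Delta> * \<rho> z - \<rho> y"
        using \<open>0 < \<epsilon>\<close> by (simp add: push_density_def \<Delta>_def z_def)
      then show ?thesis unfolding distrib_left[of \<epsilon>] by (simp only:) (simp add: algebra_simps)
    qed
    then have "\<bar>\<epsilon> * ((push_density \<rho> \<epsilon> y - \<rho> y) / \<epsilon> + (D\<rho> y \<bullet> n y + \<rho> y * trace (Dn y)))\<bar> <
        3 * (\<epsilon> * (\<eta> / 4))"
      using t1 t2 t3 by linarith
    also have "\<dots> < \<epsilon> * \<eta>" using \<open>0 < \<epsilon>\<close> \<open>\<eta> > 0\<close> by simp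
    finally show ?thesis using \<open>0 < \<epsilon>\<close> by (simp add: abs_mult)
  qed
  ultimately show thesis using that by blast
qed

end

section \<open>The derivative of the normalized gradient\<close>

lemma outer_product_vector_mul: "(\<chi> i j. v $ i * w $ j) *v h = (w \<bullet> h) *\<^sub>R v"
  for v :: "real^'m" and w h :: "real^'n"
  by (simp add: vec_eq_iff matrix_vector_mult_def inner_vec_def sum_distrib_left mult_ac)

text \<open>With \<open>v\<close> the value and \<open>A\<close> the derivative of a field, this is
  the derivative of its normalization: \<open>A\<close> divided by \<open>norm v\<close>, with its
  range projected onto the orthogonal complement of \<open>v\<close>.\<close>

definition normalized_deriv :: "real^'n \<Rightarrow> real^'n^'n \<Rightarrow> real^'n^'n" where
  "normalized_deriv v A = inverse (norm v) *\<^sub>R A - inverse (norm v) ^ 3 *\<^sub>R (\<chi> i j. v $ i * (v v* A) $ j)"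

lemma has_derivative_normalized:
  fixes f :: "real^'n \<Rightarrow> real^'n"
  assumes "(f has_derivative (\<lambda>h. A *v h)) (at x)" "f x \<noteq> 0"
  shows "((\<lambda>x. f x /\<^sub>R norm (f x)) has_derivative (\<lambda>h. normalized_deriv (f x) A *v h)) (at x)"
proof -
  have "norm (f x) \<noteq> 0" using assms(2) by simp
  moreover have "((\<lambda>x. norm (f x)) has_derivative (\<lambda>h. (A *v h) \<bullet> sgn (f x))) (at x)"
    using has_derivative_compose[OF assms(1) has_derivative_norm[OF assms(2)]] .
  ultimately have "((\<lambda>x. inverse (norm (f x))) has_derivative
      (\<lambda>h. - (inverse (norm (f x)) * ((A *v h) \<bullet> sgn (f x)) * inverse (norm (f x))))) (at x)"
    by (rule Deriv.has_derivative_inverse)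
  from has_derivative_scaleR[OF this assms(1)]
  have "((\<lambda>x. f x /\<^sub>R norm (f x)) has_derivative
      (\<lambda>h. inverse (norm (f x)) *\<^sub>R (A *v h) +
        (- (inverse (norm (f x)) * ((A *v h) \<bullet> sgn (f x)) * inverse (norm (f x)))) *\<^sub>R f x)) (at x)" .
  \<comment> \<open>\<open>sgn (f x)\<close> supplies the third factor
    \<open>inverse (norm (f x))\<close>, hence the cube.\<close>
  moreover have "(\<lambda>h. inverse (norm (f x)) *\<^sub>R (A *v h) +
        (- (inverse (norm (f x)) * ((A *v h) \<bullet> sgn (f x)) * inverse (norm (f x)))) *\<^sub>R f x) =
      (\<lambda>h. normalized_deriv (f x) A *v h)"
    unfolding normalized_deriv_def matrix_vector_mult_diff_rdistrib
      scaleR_matrix_vector_assoc[symmetric] outer_product_vector_mul dot_lmul_matrix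
    by (simp add: sgn_div_norm inner_commute[of "A *v _" "f x"] power3_eq_cube mult_ac)
  ultimately show ?thesis by simp
qed

lemma continuous_on_normalized_deriv:
  assumes "continuous_on S f" "continuous_on S D" "\<And>x. x \<in> S \<Longrightarrow> f x \<noteq> 0"
  shows "continuous_on S (\<lambda>x. normalized_deriv (f x) (D x))"
  unfolding normalized_deriv_def vector_matrix_mult_def
  using assms by (auto intro!: continuous_intros)

section \<open>Minimizers as maximizers of the negated function\<close>

lemma is_arg_max_uminus: "is_arg_max (\<lambda>x. - f x) P = is_arg_min f P"
  for f :: "'a \<Rightarrow> 'b::ordered_ab_group_add"
  by (simp add: is_arg_max_def is_arg_min_def fun_eq_iff)

lemma ball_argmax_uminus: "ball_argmax \<Omega> (\<lambda>x. - u x) = ball_argmin \<Omega> u"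
  by (simp add: ball_argmax_def ball_argmin_def arg_max_def arg_min_def is_arg_max_uminus fun_eq_iff)

lemma (in ascent_field) ascent_field_uminus:
  "ascent_field \<Omega> (\<lambda>x. - n x) (\<lambda>x. - Dn x) K (\<lambda>x. - u x) g"
proof
  fix x assume x: "x \<in> \<Omega>"
  show "((\<lambda>x. - n x) has_derivative (\<lambda>h. (- Dn x) *v h)) (at x)"
    using has_derivative_minus[OF field_deriv[OF x]]
    by (simp add: matrix_vector_mult_def sum_negf vec_eq_iff fun_eq_iff uminus_vec_def)
  show "GDERIV (\<lambda>x. - u x) x :> g x *\<^sub>R (- n x)"
    using has_derivative_minus[OF u_deriv[OF x, unfolded gderiv_def]] by (simp add: gderiv_def)
qed (auto simp: norm_field norm_Dn g_pos K_pos open_domain bounded_domain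
    intro!: continuous_intros cont_Dn)

section \<open>Uniform continuity away from the boundary\<close>

lemma infdist_superlevel_subset:
  assumes "a > 0" shows "{x. a \<le> infdist x (- \<Omega>)} \<subseteq> \<Omega>"
proof
  fix x assume x: "x \<in> {x. a \<le> infdist x (- \<Omega>)}"
  show "x \<in> \<Omega>"
  proof (rule ccontr)
    assume "x \<notin> \<Omega>"
    then have "infdist x (- \<Omega>) = 0" by simp
    with x assms show False by simp
  qed
qed

text \<open>For bounded \<Omega> these superlevel sets are compact subsets of \<Omega>, so
  Heine-Cantor applies to functions continuous only in the open set.\<close>

lemma uniformly_continuous_on_infdist_superlevel:
  fixes f :: "'a::heine_borel \<Rightarrow> 'b::metric_space"
  assumes "continuous_on \<Omega> f" "bounded \<Omega>" "a > 0"
  shows "uniformly_continuous_on {x. a \<le> infdist x (- \<Omega>)} f"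
proof -
  note sub = infdist_superlevel_subset[OF \<open>a > 0\<close>]
  have "closed {x. a \<le> infdist x (- \<Omega>)}"
    by (intro closed_Collect_le continuous_intros)
  with bounded_subset[OF assms(2) sub] show ?thesis
    using continuous_on_subset[OF assms(1) sub]
    by (intro compact_uniformly_continuous) (simp_all add: compact_eq_bounded_closed)
qed

text \<open>\<open>R\<close> is the \<open>o(1)\<close> term. It tends to 0 uniformly on every fixed
  inner region. The regions \<open>inner_region \<Omega> (2*\<epsilon>)\<close> grow towards the
  boundary, where continuous gradients of the densities may oscillate; uniformity there is concluded
  under uniform continuity of these gradients.\<close>

theorem proposition3p5:
  fixes \<Omega> :: "(real^'n::{finite,wellorder}) set"
    and \<mu> :: "((real^'n::_) \<times> nat) measure"
    and \<rho> :: "nat \<Rightarrow> real^'n::_ \<Rightarrow> real"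
    and D\<rho> :: "nat \<Rightarrow> real^'n::_ \<Rightarrow> real^'n::_"
    and u :: "real^'n::_ \<Rightarrow> real"
    and Du :: "real^'n::_ \<Rightarrow> real^'n::_"
    and D2u :: "real^'n::_ \<Rightarrow> real^'n::_^'n::_"
    and c c\<rho> :: real
  defines "\<Gamma> \<equiv> ball_argmax \<Omega> u"
    and "\<gamma> \<equiv> ball_argmin \<Omega> u"
    and "\<rho>m \<equiv> class_measure \<Omega> \<mu>"
  assumes domain: "open \<Omega>" "connected \<Omega>" "bounded \<Omega>" "\<Omega> \<noteq> {}"
    and mu: "prob_space \<mu>" "sets \<mu> = sets (restrict_space borel \<Omega> \<Otimes>\<^sub>M count_space {0, 1})"
    and rho_density: "\<And>i. i \<in> {0, 1} \<Longrightarrow>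
          \<rho>m i = density (restrict_space lborel \<Omega>) (\<lambda>x. ennreal (\<rho> i x))"
    and rho_nonneg: "\<And>i x. i \<in> {0, 1} \<Longrightarrow> x \<in> \<Omega> \<Longrightarrow> 0 \<le> \<rho> i x"
    and rho_C1: "\<And>i. i \<in> {0, 1} \<Longrightarrow> C1_on \<Omega> (\<rho> i) (D\<rho> i)"
    and rho_bounds: "c\<rho> > 0"
          "\<And>x. x \<in> \<Omega> \<Longrightarrow> c\<rho> < \<rho> 0 x + \<rho> 1 x \<and> \<rho> 0 x + \<rho> 1 x < 1 / c\<rho>"
    and u_C2: "C2_on_closure \<Omega> u Du D2u"
    and u_grad: "c > 0" "\<And>x. x \<in> closure \<Omega> \<Longrightarrow> norm (Du x) \<ge> c"
  shows "\<exists>R :: real \<Rightarrow> real^'n::_ \<Rightarrow> real.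
    (\<exists>\<epsilon>0>0. \<forall>\<epsilon>. 0 < \<epsilon> \<and> \<epsilon> < \<epsilon>0 \<and> \<epsilon> * max_eigenvalue \<Omega> D2u < c \<longrightarrow>
       (\<forall>x\<in>inner_region \<Omega> \<epsilon>.
          (\<exists>!y. is_arg_max u (\<lambda>y. y \<in> closure (ball x \<epsilon> \<inter> \<Omega>)) y) \<and>
          (\<exists>!y. is_arg_min u (\<lambda>y. y \<in> closure (ball x \<epsilon> \<inter> \<Omega>)) y)) \<and>
       \<Gamma> \<epsilon> \<in> borel_measurable (restrict_space borel (inner_region \<Omega> \<epsilon>)) \<and>
       \<gamma> \<epsilon> \<in> borel_measurable (restrict_space borel (inner_region \<Omega> \<epsilon>)) \<and>
       (\<exists>p. has_lebesgue_density_on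
              (measure (push_from (inner_region \<Omega> \<epsilon>) (\<Gamma> \<epsilon>) (\<rho>m 0))) p (inner_region \<Omega> (2*\<epsilon>))) \<and>
       (\<exists>q. has_lebesgue_density_on
              (measure (push_from (inner_region \<Omega> \<epsilon>) (\<gamma> \<epsilon>) (\<rho>m 1))) q (inner_region \<Omega> (2*\<epsilon>))) \<and>
       has_lebesgue_density_on
         (\<lambda>A. (measure (push_from (inner_region \<Omega> \<epsilon>) (\<Gamma> \<epsilon>) (\<rho>m 0)) A - measure (\<rho>m 0) A) / \<epsilon>
            + (measure (\<rho>m 1) A - measure (push_from (inner_region \<Omega> \<epsilon>) (\<gamma> \<epsilon>) (\<rho>m 1)) A) / \<epsilon>)
         (\<lambda>y. - divergence (\<lambda>x. (\<rho> 0 x + \<rho> 1 x) *\<^sub>R (Du x /\<^sub>R norm (Du x))) y + R \<epsilon> y)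
         (inner_region \<Omega> (2*\<epsilon>))) \<and>
    (\<forall>\<delta>>0. uniform_limit (inner_region \<Omega> \<delta>) R (\<lambda>y. 0) (at_right 0)) \<and>
    (uniformly_continuous_on \<Omega> (D\<rho> 0) \<and> uniformly_continuous_on \<Omega> (D\<rho> 1) \<longrightarrow>
       (\<forall>\<eta>>0. \<exists>\<epsilon>1>0. \<forall>\<epsilon>. 0 < \<epsilon> \<and> \<epsilon> < \<epsilon>1 \<longrightarrow> (\<forall>y\<in>inner_region \<Omega> (2*\<epsilon>). \<bar>R \<epsilon> y\<bar> < \<eta>)))"
proof -
  define n where "n = (\<lambda>x. Du x /\<^sub>R norm (Du x))"
  define Dn where "Dn = (\<lambda>x. normalized_deriv (Du x) (D2u x))"
  have Du0: "Du x \<noteq> 0" if "x \<in> closure \<Omega>" for x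
    using u_grad(1) u_grad(2)[OF that] by auto
  have cl: "x \<in> closure \<Omega>" if "x \<in> \<Omega>" for x
    using that closure_subset by blast
  \<comment> \<open>The gradient does not vanish on the compact closure and the Hessian extends
    continuously to it, so \<open>Dn\<close> is bounded; this gives \<open>K\<close>.\<close>
  have "continuous_on (closure \<Omega>) Dn"
    unfolding Dn_def using u_C2 Du0
    by (intro continuous_on_normalized_deriv) (auto simp: C2_on_closure_def)
  then have Dn_cont: "continuous_on \<Omega> Dn" and "compact (Dn ` closure \<Omega>)"
    using domain(3) closure_subset
    by (auto intro: continuous_on_subset compact_continuous_image)
  then obtain K where "K > 0" and K: "\<And>x. x \<in> \<Omega> \<Longrightarrow> norm (Dn x) \<le> K"
    using cl by (metis bounded_pos compact_imp_bounded imageI)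
  interpret up: ascent_field \<Omega> n Dn K u "\<lambda>x. norm (Du x)"
  proof
    fix x assume x: "x \<in> \<Omega>"
    note Du0 = Du0[OF cl[OF x]]
    show "norm (n x) = 1" using Du0 by (simp add: n_def)
    show "(n has_derivative (\<lambda>h. Dn x *v h)) (at x)"
      using u_C2 x Du0 unfolding n_def Dn_def C2_on_closure_def
      by (intro has_derivative_normalized) auto
    show "GDERIV u x :> norm (Du x) *\<^sub>R n x"
      using u_C2 x Du0 by (simp add: n_def C2_on_closure_def)
    show "norm (Du x) > 0" using Du0 by simp
  qed (use domain Dn_cont K \<open>K > 0\<close> in auto)
  interpret down: ascent_field \<Omega> "\<lambda>x. - n x" "\<lambda>x. - Dn x" K "\<lambda>x. - u x" "\<lambda>x. norm (Du x)"
    by (rule up.ascent_field_uminus)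

  have \<rho>: "continuous_on \<Omega> (\<rho> i)" "\<And>x. x \<in> \<Omega> \<Longrightarrow> \<rho> i x \<le> 1 / c\<rho>"
    "\<And>x. x \<in> \<Omega> \<Longrightarrow> \<bar>\<rho> i x\<bar> \<le> 1 / c\<rho>" "\<And>x. x \<in> \<Omega> \<Longrightarrow> GDERIV (\<rho> i) x :> D\<rho> i x"
    "continuous_on \<Omega> (D\<rho> i)" if i: "i \<in> {0, 1}" for i
  proof -
    show der: "GDERIV (\<rho> i) x :> D\<rho> i x" if "x \<in> \<Omega>" for x
      using rho_C1[OF i] that by (simp add: C1_on_def)
    then show "continuous_on \<Omega> (\<rho> i)"
      unfolding gderiv_def by (meson continuous_at_imp_continuous_on has_derivative_continuous)
    show "continuous_on \<Omega> (D\<rho> i)"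
      using rho_C1[OF i] by (simp add: C1_on_def)
    \<comment> \<open>The upper bound on the sum passes to each density because the other one is
      nonnegative.\<close>
    show le: "\<rho> i x \<le> 1 / c\<rho>" if "x \<in> \<Omega>" for x
      using i rho_bounds(2)[OF that] rho_nonneg[of 0 x] rho_nonneg[of 1 x] that by auto
    show "\<bar>\<rho> i x\<bar> \<le> 1 / c\<rho>" if "x \<in> \<Omega>" for x
      using le[OF that] rho_nonneg[OF i that] by simp
  qed

  define F where "F = (\<lambda>x. (\<rho> 0 x + \<rho> 1 x) *\<^sub>R (Du x /\<^sub>R norm (Du x)))"
  have div_F: "divergence F y = (D\<rho> 0 y + D\<rho> 1 y) \<bullet> n y + (\<rho> 0 y + \<rho> 1 y) * trace (Dn y)"
    if "y \<in> \<Omega>" for y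
  proof -
    have "GDERIV (\<lambda>x. \<rho> 0 x + \<rho> 1 x) y :> D\<rho> 0 y + D\<rho> 1 y"
      using \<rho>(4)[of 0 y] \<rho>(4)[of 1 y] that by (intro GDERIV_add) auto
    from divergence_scaleR[OF this up.field_deriv[OF that]] show ?thesis
      by (simp add: F_def n_def)
  qed

  define p where "p = up.push_density (\<rho> 0)"
  define q where "q = down.push_density (\<rho> 1)"
  \<comment> \<open>Defined as the exact difference, so that the density formula holds by
    construction and only the smallness of \<open>R\<close> needs analysis.\<close>
  define R where "R = (\<lambda>\<epsilon> y. (p \<epsilon> y - \<rho> 0 y) / \<epsilon> + (\<rho> 1 y - q \<epsilon> y) / \<epsilon> + divergence F y)"

  \<comment> \<open>Serves both limits: \<open>S\<close> is a set at fixed depth for the local one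
    and all of \<Omega> for the global one.\<close>
  have R_small: "\<exists>d>0. \<forall>\<epsilon> y. 0 < \<epsilon> \<and> \<epsilon> < d \<and> cball y \<epsilon> \<subseteq> S \<longrightarrow> \<bar>R \<epsilon> y\<bar> < \<eta>"
    if S: "S \<subseteq> \<Omega>" "uniformly_continuous_on S (D\<rho> 0)" "uniformly_continuous_on S (D\<rho> 1)"
      and "\<eta> > 0" for S \<eta>
  proof -
    have "1 / c\<rho> > 0" "\<eta> / 2 > 0" using rho_bounds(1) \<open>\<eta> > 0\<close> by auto
    note expand = up.push_density_expansion[OF \<rho>(4,3) S(1) _ this, of 0]
      down.push_density_expansion[OF \<rho>(4,3) S(1) _ this, of 1]
    obtain d0 where "d0 > 0" and d0: "\<And>\<epsilon> y. 0 < \<epsilon> \<Longrightarrow> \<epsilon> < d0 \<Longrightarrow> cball y \<epsilon> \<subseteq> S \<Longrightarrow>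
        \<bar>(p \<epsilon> y - \<rho> 0 y) / \<epsilon> + (D\<rho> 0 y \<bullet> n y + \<rho> 0 y * trace (Dn y))\<bar> < \<eta> / 2"
      using expand(1) S(2) unfolding p_def by auto
    obtain d1 where "d1 > 0" and d1: "\<And>\<epsilon> y. 0 < \<epsilon> \<Longrightarrow> \<epsilon> < d1 \<Longrightarrow> cball y \<epsilon> \<subseteq> S \<Longrightarrow>
        \<bar>(q \<epsilon> y - \<rho> 1 y) / \<epsilon> + (D\<rho> 1 y \<bullet> (- n y) + \<rho> 1 y * trace (- Dn y))\<bar> < \<eta> / 2"
      using expand(2) S(3) unfolding q_def by auto
    have "\<bar>R \<epsilon> y\<bar> < \<eta>" if "0 < \<epsilon>" "\<epsilon> < min d0 d1" "cball y \<epsilon> \<subseteq> S" for \<epsilon> y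
    proof -
      have "y \<in> cball y \<epsilon>" using \<open>0 < \<epsilon>\<close> by simp
      then have "y \<in> \<Omega>" using that(3) S(1) by blast
      have "trace (- Dn y) = - trace (Dn y)"
        by (simp add: trace_def sum_negf)
      \<comment> \<open>The divergence splits between the two densities. For \<open>\<rho> 1\<close>
        the field \<open>- n\<close> reverses the sign of its part, which the subtraction
        restores.\<close>
      then have "R \<epsilon> y = ((p \<epsilon> y - \<rho> 0 y) / \<epsilon> + (D\<rho> 0 y \<bullet> n y + \<rho> 0 y * trace (Dn y))) -
          ((q \<epsilon> y - \<rho> 1 y) / \<epsilon> + (D\<rho> 1 y \<bullet> (- n y) + \<rho> 1 y * trace (- Dn y)))"
        by (simp add: R_def div_F[OF \<open>y \<in> \<Omega>\<close>] inner_add_left diff_divide_distrib algebra_simps)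
      then show ?thesis using d0[of \<epsilon> y] d1[of \<epsilon> y] that by linarith
    qed
    moreover have "min d0 d1 > 0" using \<open>d0 > 0\<close> \<open>d1 > 0\<close> by simp
    ultimately show ?thesis by blast
  qed

  \<comment> \<open>Below this value \<open>\<epsilon> * L < 1\<close> holds for both
    fields.\<close>
  define \<epsilon>0 where "\<epsilon>0 = min (1 / up.L) (1 / down.L)"
  have "\<epsilon>0 > 0" using up.L_pos down.L_pos by (simp add: \<epsilon>0_def)
  have density: "(\<forall>x\<in>inner_region \<Omega> \<epsilon>.
        (\<exists>!y. is_arg_max u (\<lambda>y. y \<in> closure (ball x \<epsilon> \<inter> \<Omega>)) y) \<and>
        (\<exists>!y. is_arg_min u (\<lambda>y. y \<in> closure (ball x \<epsilon> \<inter> \<Omega>)) y)) \<and>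
     \<Gamma> \<epsilon> \<in> borel_measurable (restrict_space borel (inner_region \<Omega> \<epsilon>)) \<and>
     \<gamma> \<epsilon> \<in> borel_measurable (restrict_space borel (inner_region \<Omega> \<epsilon>)) \<and>
     (\<exists>p. has_lebesgue_density_on
            (measure (push_from (inner_region \<Omega> \<epsilon>) (\<Gamma> \<epsilon>) (\<rho>m 0))) p (inner_region \<Omega> (2*\<epsilon>))) \<and>
     (\<exists>q. has_lebesgue_density_on
            (measure (push_from (inner_region \<Omega> \<epsilon>) (\<gamma> \<epsilon>) (\<rho>m 1))) q (inner_region \<Omega> (2*\<epsilon>))) \<and>
     has_lebesgue_density_on
       (\<lambda>A. (measure (push_from (inner_region \<Omega> \<epsilon>) (\<Gamma> \<epsilon>) (\<rho>m 0)) A - measure (\<rho>m 0) A) / \<epsilon>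
          + (measure (\<rho>m 1) A - measure (push_from (inner_region \<Omega> \<epsilon>) (\<gamma> \<epsilon>) (\<rho>m 1)) A) / \<epsilon>)
       (\<lambda>y. - divergence F y + R \<epsilon> y) (inner_region \<Omega> (2*\<epsilon>))"
    if "0 < \<epsilon>" "\<epsilon> < \<epsilon>0" for \<epsilon>
  proof -
    have L: "\<epsilon> * up.L < 1" "\<epsilon> * down.L < 1"
      using \<open>\<epsilon> < \<epsilon>0\<close> up.L_pos down.L_pos by (auto simp: \<epsilon>0_def field_simps)
    let ?T = "inner_region \<Omega> (2 * \<epsilon>)"
    have \<Gamma>: "has_lebesgue_density_on (measure (push_from (inner_region \<Omega> \<epsilon>) (\<Gamma> \<epsilon>) (\<rho>m 0))) (p \<epsilon>) ?T"
      unfolding \<Gamma>_def p_def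
      using rho_density[of 0] \<rho>(1,2)[of 0] rho_nonneg[of 0] \<open>0 < \<epsilon>\<close> L(1)
      by (intro up.push_from_density[where B = "1 / c\<rho>"]) auto
    have \<gamma>: "has_lebesgue_density_on (measure (push_from (inner_region \<Omega> \<epsilon>) (\<gamma> \<epsilon>) (\<rho>m 1))) (q \<epsilon>) ?T"
      unfolding \<gamma>_def q_def ball_argmax_uminus[symmetric]
      using rho_density[of 1] \<rho>(1,2)[of 1] rho_nonneg[of 1] \<open>0 < \<epsilon>\<close> L(2)
      by (intro down.push_from_density[where B = "1 / c\<rho>"]) auto
    have \<rho>m: "has_lebesgue_density_on (measure (\<rho>m i)) (\<rho> i) ?T" if i: "i \<in> {0, 1}" for i
    proof -
      have int: "set_integrable lborel A (\<rho> i)" if "A \<in> sets borel" "A \<subseteq> ?T" for A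
        using that inner_region_subset
        by (intro set_integrable_bounded_density[OF domain(1,3) \<rho>(1,3)[OF i]]) blast+
      moreover have "measure (\<rho>m i) A = (LINT x:A|lborel. \<rho> i x)" if "A \<in> sets borel" "A \<subseteq> ?T" for A
        using that inner_region_subset
        by (intro measure_density_restrict[OF domain(1) \<rho>(1)[OF i] rho_nonneg[OF i] int[OF that]
              _ _ rho_density[OF i]]) blast+
      ultimately show ?thesis
        using open_inner_region[OF domain(1)] by (auto simp: has_lebesgue_density_on_def)
    qed
    have total: "has_lebesgue_density_on
        (\<lambda>A. (measure (push_from (inner_region \<Omega> \<epsilon>) (\<Gamma> \<epsilon>) (\<rho>m 0)) A - measure (\<rho>m 0) A) / \<epsilon>
          + (measure (\<rho>m 1) A - measure (push_from (inner_region \<Omega> \<epsilon>) (\<gamma> \<epsilon>) (\<rho>m 1)) A) / \<epsilon>)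
        (\<lambda>y. - divergence F y + R \<epsilon> y) ?T"
      unfolding R_def
      using has_lebesgue_density_on_add[OF
          has_lebesgue_density_on_divide[OF has_lebesgue_density_on_diff[OF \<Gamma> \<rho>m[of 0]], of \<epsilon>]
          has_lebesgue_density_on_divide[OF has_lebesgue_density_on_diff[OF \<rho>m[of 1] \<gamma>], of \<epsilon>]]
      by simp
    show ?thesis
      using \<Gamma> \<gamma> total up.ex1_arg_max[OF _ \<open>0 < \<epsilon>\<close> L(1)]
        down.ex1_arg_max[OF _ \<open>0 < \<epsilon>\<close> L(2), unfolded is_arg_max_uminus]
        up.borel_measurable_ball_argmax[OF \<open>0 < \<epsilon>\<close> L(1), folded \<Gamma>_def]
        down.borel_measurable_ball_argmax[OF \<open>0 < \<epsilon>\<close> L(2), unfolded ball_argmax_uminus, folded \<gamma>_def]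
      by blast
  qed

  have local_limit: "uniform_limit (inner_region \<Omega> \<delta>) R (\<lambda>y. 0) (at_right 0)" if "\<delta> > 0" for \<delta>
  proof (rule uniform_limitI)
    fix e :: real assume "e > 0"
    \<comment> \<open>Half of \<delta> is reserved for the radius: balls of radius below
      \<open>\<delta> / 2\<close> around points of depth \<delta> stay in this set.\<close>
    define S where "S = {x. \<delta> / 2 \<le> infdist x (- \<Omega>)}"
    have "S \<subseteq> \<Omega>" "uniformly_continuous_on S (D\<rho> 0)" "uniformly_continuous_on S (D\<rho> 1)"
      unfolding S_def using infdist_superlevel_subset[of "\<delta> / 2" \<Omega>] \<open>\<delta> > 0\<close>
        uniformly_continuous_on_infdist_superlevel[OF \<rho>(5)[of 0] domain(3), of "\<delta> / 2"]
        uniformly_continuous_on_infdist_superlevel[OF \<rho>(5)[of 1] domain(3), of "\<delta> / 2"]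
      by auto
    then obtain d where "d > 0" and d: "\<And>\<epsilon> y. 0 < \<epsilon> \<Longrightarrow> \<epsilon> < d \<Longrightarrow> cball y \<epsilon> \<subseteq> S \<Longrightarrow> \<bar>R \<epsilon> y\<bar> < e"
      using R_small[of S e] \<open>e > 0\<close> by blast
    have "\<forall>y\<in>inner_region \<Omega> \<delta>. dist (R \<epsilon> y) 0 < e" if "0 < \<epsilon>" "\<epsilon> < min d (\<delta> / 2)" for \<epsilon>
    proof
      fix y assume y: "y \<in> inner_region \<Omega> \<delta>"
      have "cball y \<epsilon> \<subseteq> S"
      proof
        fix x assume "x \<in> cball y \<epsilon>"
        then show "x \<in> S"
          using infdist_triangle[of y "- \<Omega>" x] y that by (auto simp: S_def inner_region_def)
      qed
      then show "dist (R \<epsilon> y) 0 < e" using d[of \<epsilon> y] that by simp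
    qed
    moreover have "min d (\<delta> / 2) > 0" using \<open>d > 0\<close> \<open>\<delta> > 0\<close> by simp
    ultimately show "\<forall>\<^sub>F \<epsilon> in at_right 0. \<forall>y\<in>inner_region \<Omega> \<delta>. dist (R \<epsilon> y) 0 < e"
      by (intro eventually_at_rightI[of 0 "min d (\<delta> / 2)"]) auto
  qed

  have global_limit: "\<exists>\<epsilon>1>0. \<forall>\<epsilon>. 0 < \<epsilon> \<and> \<epsilon> < \<epsilon>1 \<longrightarrow> (\<forall>y\<in>inner_region \<Omega> (2*\<epsilon>). \<bar>R \<epsilon> y\<bar> < \<eta>)"
    if uc: "uniformly_continuous_on \<Omega> (D\<rho> 0)" "uniformly_continuous_on \<Omega> (D\<rho> 1)" "\<eta> > 0" for \<eta>
  proof -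
    obtain d where "d > 0" and d: "\<And>\<epsilon> y. 0 < \<epsilon> \<Longrightarrow> \<epsilon> < d \<Longrightarrow> cball y \<epsilon> \<subseteq> \<Omega> \<Longrightarrow> \<bar>R \<epsilon> y\<bar> < \<eta>"
      using R_small[OF order_refl uc] by blast
    moreover have "cball y \<epsilon> \<subseteq> \<Omega>" if "0 < \<epsilon>" "y \<in> inner_region \<Omega> (2 * \<epsilon>)" for \<epsilon> y
      using that by (intro cball_subset_if_infdist_gt) (simp add: inner_region_def)
    ultimately show ?thesis by blast
  qed

  show ?thesis
    unfolding F_def[symmetric]
  proof (rule exI[of _ R], rule conjI[OF exI[of _ \<epsilon>0] conjI], goal_cases)
    case 1
    show ?case
      by (rule conjI[OF \<open>\<epsilon>0 > 0\<close>], rule allI, rule impI, rule density) simp_all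
  next
    case 2
    show ?case by (intro allI impI local_limit)
  next
    case 3
    show ?case by (intro allI impI, rule global_limit) simp_all
  qed
qed

end
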